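(* Let $m\ge 1$ be an integer, let $X(m)=\left\{\sum_{n=1}^{\infty}\frac{\varepsilon_n}{(2m+2)^n} : \varepsilon_n\in\{0,2,3,\dots,2m+1,2m+3\}\text{ for all } n\ge 1\right\}\subset\mathbb{R}$, and let $X_C(m)$ be the boundary of $X(m)$ in $\mathbb{R}$. Then $X_C(m)$ has Hausdorff dimension $\dim_H X_C(m)=\log_{2m+2}3$.
   Context: The digit set $\{0,2,3,\dots,2m+1,2m+3\}$ consists of $0$, all integers from $2$ to $2m+1$, and $2m+3$. $\dim_H$ denotes the usual Hausdorff dimension. *)

theory Defs
  imports "HOL-Analysis.Analysis"
begin

text \<open>
  The weight \<open>(diam U)^s\<close> of a covering set, with the usual conventions that the empty set has
  weight \<open>0\<close> and that a nonempty set has weight \<open>1\<close> for \<open>s = 0\<close>. The cases are separated because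
  \<open>0 powr 0 = 0\<close>.
\<close>
definition diam_weight :: "real \<Rightarrow> 'a::metric_space set \<Rightarrow> ennreal" where
  "diam_weight s U =
     (if U = {} then 0 else if s = 0 then 1 else ennreal (diameter U powr s))"

text \<open>
  Countable covers are sequences of sets; finite covers are included by padding with empty sets.
  Boundedness is required explicitly because \<^const>\<open>diameter\<close> is a real number and has no
  meaning for unbounded sets.
\<close>
definition delta_covers :: "real \<Rightarrow> 'a::metric_space set \<Rightarrow> (nat \<Rightarrow> 'a set) set" where
  "delta_covers \<delta> A =
     {U. A \<subseteq> (\<Union>i. U i) \<and> (\<forall>i. bounded (U i) \<and> diameter (U i) \<le> \<delta>)}"

definition hausdorff_premeasure :: "real \<Rightarrow> real \<Rightarrow> 'a::metric_space set \<Rightarrow> ennreal" where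
  "hausdorff_premeasure s \<delta> A = (INF U\<in>delta_covers \<delta> A. \<Sum>i. diam_weight s (U i))"

definition hausdorff_measure :: "real \<Rightarrow> 'a::metric_space set \<Rightarrow> ennreal" where
  "hausdorff_measure s A = (SUP \<delta>\<in>{0<..}. hausdorff_premeasure s \<delta> A)"

text \<open>The infimum is taken in the extended reals, so it is \<open>\<infinity>\<close> if no such \<open>s\<close> exists.\<close>
definition hausdorff_dim :: "'a::metric_space set \<Rightarrow> ereal" where
  "hausdorff_dim A = (INF s\<in>{s. 0 \<le> s \<and> hausdorff_measure s A = 0}. ereal s)"

definition digits :: "nat \<Rightarrow> nat set" where
  "digits m = {0} \<union> {2..2 * m + 1} \<union> {2 * m + 3}"

text \<open>The series starts at index \<open>1\<close>; hence \<open>Suc n\<close>, and the value \<open>\<epsilon> 0\<close> is irrelevant.\<close>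
definition X :: "nat \<Rightarrow> real set" where
  "X m = {(\<Sum>n. real (\<epsilon> (Suc n)) / real (2 * m + 2) ^ Suc n) | \<epsilon> :: nat \<Rightarrow> nat.
            \<forall>n\<ge>1. \<epsilon> n \<in> digits m}"

definition X_C :: "nat \<Rightarrow> real set" where
  "X_C m = frontier (X m)"

end

theory Submission
  imports Defs
begin

text \<open>
  Put \<open>b = 2 m + 2\<close>. The digits form a complete residue system modulo \<open>b\<close>, so the integer
  translates of the compact set \<open>X m\<close> cover the line. Hence a boundary point of \<open>X m\<close> lies in some
  \<open>X m + k\<close> with \<open>k \<noteq> 0\<close>, and \<open>k = 1\<close> or \<open>k = -1\<close> because \<open>X m\<close> is contained in \<open>[0, 2)\<close>.

  Comparing first digits of two expansions whose values differ by \<open>1\<close> or \<open>-1\<close> shows that their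
  tails again differ by \<open>1\<close> or \<open>-1\<close>, and leaves only a few pairs of first digits
  (\<open>neighbour_step\<close>). These show that the points \<open>x\<close> with \<open>x\<close> and \<open>x + 1\<close> in \<open>X m\<close> form the set
  \<open>C\<close> of all expansions in base \<open>b\<close> with digits \<open>0\<close>, \<open>1\<close>, \<open>2\<close>. So the boundary is contained in
  \<open>C \<union> (1 + C)\<close>. Conversely, \<open>1 + C\<close> is contained in both \<open>X m\<close> and \<open>1 + X m\<close>, while the points
  of \<open>X m\<close> that lie in no other translate are dense in it; therefore every point of \<open>1 + C\<close> is a
  limit of points outside \<open>X m\<close>, that is, a boundary point.

  It remains to bound dimensions by \<open>log\<^sub>b 3\<close>. From above, \<open>C\<close> is covered by \<open>3\<^sup>N\<close> intervals of length
  at most \<open>b\<close> to the power \<open>-N\<close>. From below, since \<open>b \<ge> 4\<close>, reading the digits of a point of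
  \<open>C\<close> in base \<open>3\<close> is a Hoelder map of exponent \<open>log\<^sub>b 3\<close> onto the unit interval.
\<close>

section \<open>Bounds for the Hausdorff dimension\<close>

lemma hausdorff_dim_le:
  assumes "t \<ge> 0" and "\<And>s. s > t \<Longrightarrow> hausdorff_measure s A = 0"
  shows "hausdorff_dim A \<le> ereal t"
proof (rule ereal_le_epsilon2)
  fix e :: real assume "e > 0"
  have "hausdorff_dim A \<le> ereal (t + e)"
    unfolding hausdorff_dim_def
    by (rule INF_lower) (use \<open>e > 0\<close> assms in auto)
  then show "hausdorff_dim A \<le> ereal t + ereal e" by simp
qed

lemma hausdorff_premeasure_le_intervals:
  fixes A :: "real set"
  assumes s: "s > 0" and r: "0 \<le> r" "r \<le> \<delta>"
    and F: "finite F" "card F \<le> n" and cov: "A \<subseteq> (\<Union>p\<in>F. {p..p + r})"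
  shows "hausdorff_premeasure s \<delta> A \<le> ennreal (real n * r powr s)"
proof -
  obtain f where f: "bij_betw f {..<card F} F"
    using bij_betw_from_nat_into_finite[OF F(1)] by blast
  define U where "U i = (if i < card F then {f i..f i + r} else {})" for i :: nat
  have diam: "diameter {p..p + r} = r" for p :: real
    using r(1) by simp
  have "A \<subseteq> (\<Union>i. U i)"
  proof
    fix x assume "x \<in> A"
    then obtain p where p: "p \<in> F" "x \<in> {p..p + r}" using cov by blast
    then obtain i where "i < card F" "f i = p"
      using f unfolding bij_betw_def by (metis imageE lessThan_iff)
    then show "x \<in> (\<Union>i. U i)" using p by (auto simp: U_def intro!: exI[of _ i])
  qed
  moreover have "bounded (U i) \<and> diameter (U i) \<le> \<delta>" for i
    using r diam by (auto simp: U_def)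
  ultimately have "U \<in> delta_covers \<delta> A" by (auto simp: delta_covers_def)
  then have "hausdorff_premeasure s \<delta> A \<le> (\<Sum>i. diam_weight s (U i))"
    unfolding hausdorff_premeasure_def by (rule INF_lower)
  also have "\<dots> = (\<Sum>i<card F. diam_weight s (U i))"
    by (rule suminf_finite) (auto simp: U_def diam_weight_def)
  also have "\<dots> \<le> (\<Sum>i<card F. ennreal (r powr s))"
  proof (rule sum_mono)
    fix i assume "i \<in> {..<card F}"
    then have "U i = {f i..f i + r}" by (simp add: U_def)
    then show "diam_weight s (U i) \<le> ennreal (r powr s)"
      using s diam[of "f i"] by (simp add: diam_weight_def)
  qed
  also have "\<dots> = ennreal (real (card F) * r powr s)"
    by (simp add: ennreal_mult ennreal_of_nat_eq_real_of_nat)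
  also have "\<dots> \<le> ennreal (real n * r powr s)"
    using F(2) by (intro ennreal_leI mult_right_mono) auto
  finally show ?thesis .
qed

text \<open>
  A mass distribution principle without a measure on \<open>A\<close>: if part of \<open>A\<close> is mapped onto the
  unit interval by a \<open>t\<close>-Hoelder map, then covers of \<open>A\<close> of small total weight would
  yield covers of the unit interval of small total length. The map is given by
  the parametrisation \<open>g i \<mapsto> h i\<close>.
\<close>
lemma hausdorff_dim_ge_if_hoelder:
  fixes A :: "'a::metric_space set" and g :: "'i \<Rightarrow> 'a" and h :: "'i \<Rightarrow> real"
  assumes t: "t > 0" and K: "K > 0"
    and g: "\<And>i. i \<in> I \<Longrightarrow> g i \<in> A"
    and h: "{0..1} \<subseteq> h ` I"
    and hoelder: "\<And>i j. i \<in> I \<Longrightarrow> j \<in> I \<Longrightarrow> \<bar>h i - h j\<bar> \<le> K * dist (g i) (g j) powr t"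
  shows "ereal t \<le> hausdorff_dim A"
  unfolding hausdorff_dim_def
proof (rule INF_greatest, clarify)
  fix s :: real assume s: "0 \<le> s" "hausdorff_measure s A = 0"
  show "ereal t \<le> ereal s"
  proof (rule ccontr)
    assume "\<not> ereal t \<le> ereal s"
    then have st: "s < t" by simp
    have "hausdorff_premeasure s 1 A \<le> hausdorff_measure s A"
      unfolding hausdorff_measure_def by (rule SUP_upper) simp
    then have "hausdorff_premeasure s 1 A < ennreal (1 / (2 * K))"
      using s K by simp
    then obtain U where U: "U \<in> delta_covers 1 A"
      and small: "(\<Sum>i. diam_weight s (U i)) < ennreal (1 / (2 * K))"
      unfolding hausdorff_premeasure_def INF_less_iff by blast
    \<comment> \<open>Each \<open>U k\<close> is replaced by an interval \<open>J k\<close> around one value of \<open>h\<close> on it.\<close>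
    define P where "P k = {i \<in> I. g i \<in> U k}" for k
    define J where "J k = (if P k = {} then {} else
        {h (SOME i. i \<in> P k) - K * diameter (U k) powr t ..
         h (SOME i. i \<in> P k) + K * diameter (U k) powr t})" for k
    have Ubd: "bounded (U k)" "diameter (U k) \<le> 1" for k
      using U by (auto simp: delta_covers_def)
    have hJ: "h i \<in> J k" if "i \<in> P k" for i k
    proof -
      define c where "c = (SOME i. i \<in> P k)"
      have c: "c \<in> P k" unfolding c_def using that by (rule someI)
      have "dist (g i) (g c) \<le> diameter (U k)"
        using that c Ubd(1)[of k] by (intro diameter_bounded_bound) (auto simp: P_def)
      then have "K * dist (g i) (g c) powr t \<le> K * diameter (U k) powr t"
        using K t by (intro mult_left_mono powr_mono2) auto
      then have "\<bar>h i - h c\<bar> \<le> K * diameter (U k) powr t"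
        using hoelder[of i c] that c by (auto simp: P_def)
      then show ?thesis using that by (auto simp: J_def c_def[symmetric])
    qed
    have "{0..1} \<subseteq> (\<Union>k. J k)"
    proof
      fix y :: real assume "y \<in> {0..1}"
      then obtain i where i: "i \<in> I" "y = h i" using h by blast
      then obtain k where "g i \<in> U k" using g U by (fastforce simp: delta_covers_def)
      then show "y \<in> (\<Union>k. J k)" using hJ[of i k] i by (auto simp: P_def)
    qed
    then have "emeasure lborel {0..1::real} \<le> emeasure lborel (\<Union>k. J k)"
      by (intro emeasure_mono) (auto simp: J_def)
    also have "\<dots> \<le> (\<Sum>k. emeasure lborel (J k))"
      by (rule emeasure_subadditive_countably) (auto simp: J_def)
    also have "\<dots> \<le> (\<Sum>k. ennreal (2 * K) * diam_weight s (U k))"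
    proof (rule suminf_le)
      fix k
      show "emeasure lborel (J k) \<le> ennreal (2 * K) * diam_weight s (U k)"
      proof (cases "P k = {}")
        case True
        then show ?thesis by (simp add: J_def)
      next
        case False
        then have ne: "U k \<noteq> {}" by (auto simp: P_def)
        have d0: "0 \<le> diameter (U k)" using Ubd(1) by (rule diameter_ge_0)
        have "emeasure lborel (J k) = ennreal (2 * K * diameter (U k) powr t)"
          using False K by (simp add: J_def)
        also have "\<dots> = ennreal (2 * K) * ennreal (diameter (U k) powr t)"
          using K by (simp add: ennreal_mult)
        also have "\<dots> \<le> ennreal (2 * K) * diam_weight s (U k)"
        proof (rule mult_left_mono)
          \<comment> \<open>The diameters are at most \<open>1\<close>, so lowering the exponent increases the weight.\<close>
          show "ennreal (diameter (U k) powr t) \<le> diam_weight s (U k)"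
          proof (cases "s = 0")
            case True
            have "diameter (U k) powr t \<le> 1 powr t"
              using d0 Ubd(2) t by (intro powr_mono2) auto
            then show ?thesis using ne True by (simp add: diam_weight_def)
          next
            case False
            have "diameter (U k) powr t \<le> diameter (U k) powr s"
              using d0 Ubd(2)[of k] st by (intro powr_mono') auto
            then show ?thesis using ne False by (simp add: diam_weight_def ennreal_leI)
          qed
        qed simp
        finally show ?thesis .
      qed
    qed auto
    also have "\<dots> = ennreal (2 * K) * (\<Sum>k. diam_weight s (U k))" by simp
    also have "\<dots> < ennreal (2 * K) * ennreal (1 / (2 * K))"
      using small K by (intro ennreal_mult_strict_left_mono) auto
    also have "\<dots> = 1" using K by (simp flip: ennreal_mult)
    finally show False by simp
  qed
qed

section \<open>Digit expansions in a real base\<close>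

text \<open>
  The value in base \<open>b\<close> of the sequence \<open>e\<close> of digits after the point; the first digit \<open>e 0\<close> has
  weight \<open>1 / b\<close>. Digits are arbitrary real numbers.
\<close>
definition expansion :: "real \<Rightarrow> (nat \<Rightarrow> real) \<Rightarrow> real" where
  "expansion b e = (\<Sum>n. e n / b ^ Suc n)"

text \<open>
  The values of all expansions with digits in \<open>D\<close>. For \<open>b > 1\<close> and a finite nonempty set \<open>D\<close>
  this is the attractor of the maps \<open>x \<mapsto> (d + x) / b\<close> with \<open>d \<in> D\<close>.
\<close>
definition expansions :: "real \<Rightarrow> real set \<Rightarrow> real set" where
  "expansions b D = {expansion b e | e. \<forall>n. e n \<in> D}"

lemma sums_geometric_digits:
  fixes b :: real assumes "b > 1"
  shows "(\<lambda>n. M / b ^ Suc n) sums (M / (b - 1))"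
proof -
  have "(\<lambda>n. M / b * (1 / b) ^ n) sums (M / b * (1 / (1 - 1 / b)))"
    using assms by (intro sums_mult geometric_sums) auto
  moreover have "M / b * (1 / (1 - 1 / b)) = M / (b - 1)"
    using assms by (simp add: field_simps)
  moreover have "(\<lambda>n. M / b * (1 / b) ^ n) = (\<lambda>n. M / b ^ Suc n)"
    by (simp add: power_one_over)
  ultimately show ?thesis by (simp only:)
qed

lemma summable_expansion:
  fixes b :: real assumes "b > 1" and "\<And>n. e n \<in> {0..M}"
  shows "summable (\<lambda>n. e n / b ^ Suc n)"
proof (rule summable_comparison_test)
  show "summable (\<lambda>n. M / b ^ Suc n)"
    using sums_geometric_digits[OF assms(1)] by (rule sums_summable)
  show "\<exists>N. \<forall>n\<ge>N. norm (e n / b ^ Suc n) \<le> M / b ^ Suc n"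
    using assms by (auto intro!: divide_right_mono)
qed

lemma expansion_bounds:
  fixes b :: real assumes "b > 1" and "\<And>n. e n \<in> {0..M}"
  shows "0 \<le> expansion b e" and "expansion b e \<le> M / (b - 1)"
proof -
  note sm = summable_expansion[of b e M, OF assms]
  show "0 \<le> expansion b e"
    unfolding expansion_def using assms by (intro suminf_nonneg[OF sm]) auto
  have "expansion b e \<le> (\<Sum>n. M / b ^ Suc n)"
    unfolding expansion_def using assms
    by (intro suminf_le sm sums_summable[OF sums_geometric_digits] divide_right_mono) auto
  then show "expansion b e \<le> M / (b - 1)"
    using sums_unique[OF sums_geometric_digits[OF assms(1)]] by simp
qed

lemma expansion_split:
  fixes b :: real assumes "b > 1" and "\<And>n. e n \<in> {0..M}"
  shows "expansion b e = (\<Sum>n<N. e n / b ^ Suc n) + expansion b (\<lambda>n. e (n + N)) / b ^ N"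
proof -
  have sm: "summable (\<lambda>n. e (n + N) / b ^ Suc n)"
    using assms by (intro summable_expansion) auto
  have "expansion b e = (\<Sum>n. e (n + N) / b ^ Suc (n + N)) + (\<Sum>n<N. e n / b ^ Suc n)"
    unfolding expansion_def by (rule suminf_split_initial_segment[OF summable_expansion[OF assms]])
  also have "(\<Sum>n. e (n + N) / b ^ Suc (n + N)) = (\<Sum>n. e (n + N) / b ^ Suc n / b ^ N)"
    by (simp add: power_add field_simps)
  also have "\<dots> = expansion b (\<lambda>n. e (n + N)) / b ^ N"
    unfolding expansion_def using suminf_divide[OF sm] by simp
  finally show ?thesis by simp
qed

lemma expansion_Cons:
  fixes b :: real assumes "b > 1" and "\<And>n. e n \<in> {0..M}"
  shows "expansion b e = (e 0 + expansion b (\<lambda>n. e (Suc n))) / b"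
proof -
  have "expansion b e = (\<Sum>n<1. e n / b ^ Suc n) + expansion b (\<lambda>n. e (n + 1)) / b ^ 1"
    using assms by (rule expansion_split)
  then show ?thesis by (simp add: add_divide_distrib[symmetric])
qed

text \<open>
  A base \<open>b > 1\<close> together with finitely many real digits in \<open>{0..M}\<close>.
\<close>
locale digit_system =
  fixes b :: real and D :: "real set" and M :: real
  assumes b_gt_1: "b > 1" and finite_D: "finite D" and D_bounds: "D \<subseteq> {0..M}"
begin

lemma in_expansions_bounds:
  assumes "x \<in> expansions b D"
  shows "0 \<le> x" "x \<le> M / (b - 1)"
proof -
  obtain e where e: "\<And>n. e n \<in> D" "x = expansion b e"
    using assms by (auto simp: expansions_def)
  show "0 \<le> x" "x \<le> M / (b - 1)"
    unfolding e(2) by (rule expansion_bounds[OF b_gt_1 subsetD[OF D_bounds e(1)]])+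
qed

lemma bounded_expansions: "bounded (expansions b D)"
proof -
  have "expansions b D \<subseteq> {0..M / (b - 1)}" using in_expansions_bounds by auto
  then show ?thesis by (rule bounded_subset[OF bounded_closed_interval])
qed

lemma expansions_step:
  assumes "x \<in> expansions b D"
  obtains d y where "d \<in> D" "y \<in> expansions b D" "x = (d + y) / b"
proof -
  obtain e where e: "\<And>n. e n \<in> D" "x = expansion b e"
    using assms by (auto simp: expansions_def)
  have "x = (e 0 + expansion b (\<lambda>n. e (Suc n))) / b"
    unfolding e(2) by (rule expansion_Cons[OF b_gt_1 subsetD[OF D_bounds e(1)]])
  moreover have "expansion b (\<lambda>n. e (Suc n)) \<in> expansions b D"
    using e by (auto simp: expansions_def)
  ultimately show ?thesis using that e by blast
qed

text \<open>
  The maps \<open>x \<mapsto> (d + x) / b\<close> contract, so following their inverses inside a bounded set yields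
  the digits of an expansion.
\<close>
lemma subset_expansionsI:
  assumes K: "bounded K" and step: "\<And>x. x \<in> K \<Longrightarrow> \<exists>d\<in>D. \<exists>y\<in>K. x = (d + y) / b"
  shows "K \<subseteq> expansions b D"
proof
  fix x assume "x \<in> K"
  obtain d t where dt: "\<And>x. x \<in> K \<Longrightarrow> d x \<in> D \<and> t x \<in> K \<and> x = (d x + t x) / b"
    using step by metis
  define z where "z n = (t ^^ n) x" for n
  have zK: "z n \<in> K" for n
    by (induction n) (use dt \<open>x \<in> K\<close> in \<open>auto simp: z_def\<close>)
  have zS: "z n = (d (z n) + z (Suc n)) / b" for n
    using dt[OF zK[of n]] by (simp add: z_def)
  have partial: "x - (\<Sum>n<N. d (z n) / b ^ Suc n) = z N / b ^ N" for N
  proof (induction N)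
    case 0
    then show ?case by (simp add: z_def)
  next
    case (Suc N)
    have "z N / b ^ N = d (z N) / b ^ Suc N + z (Suc N) / b ^ Suc N"
      by (subst zS) (simp add: add_divide_distrib)
    then show ?case using Suc by simp
  qed
  obtain B where B: "\<And>y. y \<in> K \<Longrightarrow> \<bar>y\<bar> \<le> B"
    using K by (auto simp: bounded_iff)
  have lim0: "(\<lambda>N. z N / b ^ N) \<longlonglongrightarrow> 0"
  proof (rule Lim_null_comparison)
    show "\<forall>\<^sub>F N in sequentially. norm (z N / b ^ N) \<le> B * (1 / b) ^ N"
      using B[OF zK] b_gt_1 by (auto simp: power_one_over divide_right_mono)
    show "(\<lambda>N. B * (1 / b) ^ N) \<longlonglongrightarrow> 0"
      using b_gt_1 by (intro tendsto_mult_right_zero LIMSEQ_power_zero) auto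
  qed
  have "(\<lambda>N. x - z N / b ^ N) \<longlonglongrightarrow> x - 0"
    by (intro tendsto_diff tendsto_const lim0)
  moreover have "(\<lambda>N. x - z N / b ^ N) = (\<lambda>N. \<Sum>n<N. d (z n) / b ^ Suc n)"
    using partial by (auto simp: algebra_simps fun_eq_iff)
  ultimately have "(\<lambda>n. d (z n) / b ^ Suc n) sums x"
    by (simp add: sums_def)
  then have "x = expansion b (\<lambda>n. d (z n))"
    unfolding expansion_def by (rule sums_unique)
  then show "x \<in> expansions b D"
    using dt zK by (auto simp: expansions_def)
qed

lemma in_expansions_Cons:
  assumes "d \<in> D" "y \<in> expansions b D"
  shows "(d + y) / b \<in> expansions b D"
proof -
  have "insert ((d + y) / b) (expansions b D) \<subseteq> expansions b D"
  proof (rule subset_expansionsI)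
    show "bounded (insert ((d + y) / b) (expansions b D))" using bounded_expansions by simp
  next
    fix x assume x: "x \<in> insert ((d + y) / b) (expansions b D)"
    show "\<exists>c\<in>D. \<exists>z\<in>insert ((d + y) / b) (expansions b D). x = (c + z) / b"
    proof (cases "x \<in> expansions b D")
      case True
      then obtain c z where "c \<in> D" "z \<in> expansions b D" "x = (c + z) / b"
        by (rule expansions_step)
      then show ?thesis by blast
    next
      case False
      then have "x = (d + y) / b" using x by blast
      then show ?thesis using assms by blast
    qed
  qed
  then show ?thesis by simp
qed

lemma compact_expansions: "compact (expansions b D)"
proof -
  let ?E = "expansions b D"
  have "closure ?E \<subseteq> ?E"
  proof (rule subset_expansionsI)
    show "bounded (closure ?E)" using bounded_expansions by (rule bounded_closure)
    fix x assume x: "x \<in> closure ?E"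
    have cl: "closed (\<Union>d\<in>D. (\<lambda>y. (d + y) / b) ` closure ?E)"
    proof (intro closed_UN finite_D ballI compact_imp_closed compact_continuous_image)
      show "compact (closure ?E)" using bounded_expansions by simp
    qed (use b_gt_1 in \<open>auto intro!: continuous_intros\<close>)
    have "?E \<subseteq> (\<Union>d\<in>D. (\<lambda>y. (d + y) / b) ` closure ?E)"
    proof
      fix x assume "x \<in> ?E"
      then obtain d y where "d \<in> D" "y \<in> ?E" "x = (d + y) / b" by (rule expansions_step)
      then show "x \<in> (\<Union>d\<in>D. (\<lambda>y. (d + y) / b) ` closure ?E)"
        using closure_subset by blast
    qed
    then have "closure ?E \<subseteq> (\<Union>d\<in>D. (\<lambda>y. (d + y) / b) ` closure ?E)"
      using cl by (rule closure_minimal)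
    then show "\<exists>d\<in>D. \<exists>y\<in>closure ?E. x = (d + y) / b" using x by blast
  qed
  then have "closed ?E" using closure_subset_eq by blast
  then show ?thesis using bounded_expansions by (simp add: compact_eq_bounded_closed)
qed

text \<open>
  One interval for each choice of the first \<open>N\<close> digits; its length is the range of the remaining
  tails.
\<close>
lemma expansions_cover:
  "\<exists>F. finite F \<and> card F \<le> card D ^ N \<and>
     expansions b D \<subseteq> (\<Union>p\<in>F. {p..p + M / (b - 1) / b ^ N})"
proof (induction N)
  case 0
  have "expansions b D \<subseteq> {0..0 + M / (b - 1) / b ^ 0}" using in_expansions_bounds by auto
  then show ?case by (intro exI[of _ "{0}"]) auto
next
  case (Suc N)
  then obtain F where F: "finite F" "card F \<le> card D ^ N"
    "expansions b D \<subseteq> (\<Union>p\<in>F. {p..p + M / (b - 1) / b ^ N})" by blast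
  define F' where "F' = (\<Union>d\<in>D. (\<lambda>p. (d + p) / b) ` F)"
  have "card F' \<le> (\<Sum>d\<in>D. card ((\<lambda>p. (d + p) / b) ` F))"
    unfolding F'_def by (rule card_UN_le[OF finite_D])
  also have "\<dots> \<le> (\<Sum>d\<in>D. card D ^ N)"
    using F by (intro sum_mono order_trans[OF card_image_le]) auto
  finally have "card F' \<le> card D ^ Suc N" by simp
  moreover have "finite F'" using finite_D F(1) by (simp add: F'_def)
  moreover have "expansions b D \<subseteq> (\<Union>p\<in>F'. {p..p + M / (b - 1) / b ^ Suc N})"
  proof
    fix x assume "x \<in> expansions b D"
    then obtain d y where dy: "d \<in> D" "y \<in> expansions b D" "x = (d + y) / b"
      by (rule expansions_step)
    then obtain p where p: "p \<in> F" "p \<le> y" "y \<le> p + M / (b - 1) / b ^ N" using F(3) by fastforce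
    have "(d + p) / b \<le> x" using p b_gt_1 dy by (simp add: divide_right_mono)
    moreover have "x \<le> (d + (p + M / (b - 1) / b ^ N)) / b"
      using p b_gt_1 unfolding dy(3) by (intro divide_right_mono) auto
    moreover have "(d + (p + M / (b - 1) / b ^ N)) / b
        = (d + p) / b + M / (b - 1) / b ^ Suc N"
      by (simp add: add_divide_distrib)
    moreover have "(d + p) / b \<in> F'" using dy p by (auto simp: F'_def)
    ultimately show "x \<in> (\<Union>p\<in>F'. {p..p + M / (b - 1) / b ^ Suc N})" by force
  qed
  ultimately show ?case by blast
qed

end

section \<open>The expansions with digits \<open>0\<close>, \<open>1\<close> and \<open>2\<close>\<close>

lemma digit_system_012: "b > 1 \<Longrightarrow> digit_system b {0, 1, 2} 2"
  by unfold_locales auto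

lemma unit_interval_subset_ternary: "{0..1} \<subseteq> expansions 3 {0, 1, 2}"
proof -
  interpret digit_system 3 "{0, 1, 2}" 2 by (rule digit_system_012) simp
  show ?thesis
  proof (rule subset_expansionsI)
    fix x :: real assume x: "x \<in> {0..1}"
    consider "x \<le> 1/3" | "1/3 \<le> x" "x \<le> 2/3" | "2/3 \<le> x" by linarith
    then obtain d :: real where "d \<in> {0, 1, 2}" "3 * x - d \<in> {0..1}"
    proof cases
      case 1 with x show ?thesis by (intro that[of 0]) auto
    next
      case 2 with x show ?thesis by (intro that[of 1]) auto
    next
      case 3 with x show ?thesis by (intro that[of 2]) auto
    qed
    then show "\<exists>d\<in>{0, 1, 2}. \<exists>y\<in>{0..1}. x = (d + y) / 3"
      by (intro bexI[of _ d] bexI[of _ "3 * x - d"]) auto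
  qed simp
qed

text \<open>
  If two digit sequences first differ at index \<open>N\<close>, their values in base \<open>b\<close> differ by at
  least \<open>1 / b ^ (N + 2)\<close>, and their values in base \<open>3\<close> by at most \<open>1 / 3 ^ N\<close>.
\<close>
lemma expansion_012_hoelder:
  assumes b: "b \<ge> 4" and e: "\<And>n. e n \<in> {0, 1, 2}" and f: "\<And>n. f n \<in> {0, 1, 2}"
  shows "\<bar>expansion 3 e - expansion 3 f\<bar>
           \<le> 9 * \<bar>expansion b e - expansion b f\<bar> powr log b 3"
proof (cases "e = f")
  case False
  define N where "N = (LEAST n. e n \<noteq> f n)"
  have "\<exists>n. e n \<noteq> f n" using False by auto
  then have neq: "e N \<noteq> f N"
    unfolding N_def by (rule LeastI_ex[where P = "\<lambda>n. e n \<noteq> f n"])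
  have eq: "e n = f n" if "n < N" for n
    using not_less_Least[of n "\<lambda>n. e n \<noteq> f n"] that by (auto simp: N_def)
  have e2: "e n \<in> {0..2}" and f2: "f n \<in> {0..2}" for n using e[of n] f[of n] by auto
  have diff: "expansion c e - expansion c f
      = (expansion c (\<lambda>n. e (n + N)) - expansion c (\<lambda>n. f (n + N))) / c ^ N" if "c > 1" for c
    using expansion_split[of c e 2 N] expansion_split[of c f 2 N] that e2 f2 eq
    by (simp add: diff_divide_distrib)
  have "\<bar>expansion 3 (\<lambda>n. e (n + N)) - expansion 3 (\<lambda>n. f (n + N))\<bar> \<le> 1"
    using expansion_bounds[of 3 "\<lambda>n. e (n + N)" 2] expansion_bounds[of 3 "\<lambda>n. f (n + N)" 2] e2 f2
    by simp
  then have upper: "\<bar>expansion 3 e - expansion 3 f\<bar> \<le> 1 / 3 ^ N"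
    using diff[of 3] by (simp add: divide_right_mono)
  have powr_neg: "c powr - real (N + 2) = 1 / (c ^ N * c ^ 2)" if "c > 0" for c :: real
    unfolding powr_minus powr_realpow[OF that] power_add by (simp add: divide_inverse)
  define u v where "u = expansion b (\<lambda>n. e (Suc n + N))" and "v = expansion b (\<lambda>n. f (Suc n + N))"
  have "2 / (b - 1) \<le> 2 / 3" "1 / b \<le> 1 / 4"
    using b by (intro divide_left_mono; simp)+
  moreover have "0 \<le> u" "u \<le> 2 / (b - 1)" "0 \<le> v" "v \<le> 2 / (b - 1)"
    unfolding u_def v_def using b e2 f2 by (auto intro!: expansion_bounds(1)[of b _ 2] expansion_bounds(2))
  moreover have "\<bar>e N - f N\<bar> \<ge> 1"
    using neq e[of N] f[of N] by (elim insertE emptyE) simp_all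
  ultimately have "1 / b \<le> \<bar>e N + u - (f N + v)\<bar>" by linarith
  then have "1 / b / b / b ^ N \<le> \<bar>e N + u - (f N + v)\<bar> / b / b ^ N"
    using b by (intro divide_right_mono) auto
  also have "\<dots> = \<bar>expansion b e - expansion b f\<bar>"
    using expansion_Cons[of b "\<lambda>n. e (n + N)" 2] expansion_Cons[of b "\<lambda>n. f (n + N)" 2] e2 f2 b
    by (simp add: diff u_def v_def flip: diff_divide_distrib)
  finally have "b powr - real (N + 2) \<le> \<bar>expansion b e - expansion b f\<bar>"
    using powr_neg[of b] b by (simp only: divide_divide_eq_left mult_ac power2_eq_square)
  then have "(b powr - real (N + 2)) powr log b 3
      \<le> \<bar>expansion b e - expansion b f\<bar> powr log b 3"
    using b by (intro powr_mono2) auto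
  moreover have "(b powr - real (N + 2)) powr log b 3 = (b powr log b 3) powr - real (N + 2)"
    by (simp only: powr_powr mult.commute)
  moreover have "b powr log b 3 = 3" using b by simp
  ultimately show ?thesis using upper powr_neg[of 3] by simp
qed simp

section \<open>The boundary of the tile\<close>

locale tile =
  fixes m :: nat
  assumes m_ge_1: "m \<ge> 1"
begin

text \<open>The base of the expansions that form \<open>X m\<close>.\<close>
definition b :: real where "b = real (2 * m + 2)"

text \<open>The points \<open>x\<close> for which \<open>x\<close> and \<open>x + 1\<close> are both in \<open>X m\<close>; see
  \<open>X_inter_translate_subset\<close> and \<open>C_and_translate_subset_X\<close>.\<close>
abbreviation C :: "real set" where "C \<equiv> expansions b {0, 1, 2}"

lemma b_ge_4: "b \<ge> 4" using m_ge_1 by (simp add: b_def)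

lemma X_eq_expansions: "X m = expansions b (real ` digits m)"
proof (intro equalityI subsetI)
  fix x assume "x \<in> X m"
  then obtain \<epsilon> where "\<forall>n\<ge>1. \<epsilon> n \<in> digits m" "x = expansion b (\<lambda>n. real (\<epsilon> (Suc n)))"
    unfolding X_def expansion_def b_def by blast
  then show "x \<in> expansions b (real ` digits m)" unfolding expansions_def by auto
next
  fix x assume "x \<in> expansions b (real ` digits m)"
  then obtain e where e: "\<And>n. e n \<in> real ` digits m" "x = expansion b e"
    by (auto simp: expansions_def)
  then have "\<forall>n. \<exists>k. k \<in> digits m \<and> e n = real k" by blast
  then obtain k where k: "\<And>n. k n \<in> digits m" "\<And>n. e n = real (k n)" by metis
  \<comment> \<open>The digit at index \<open>0\<close> is never used.\<close>
  define \<epsilon> where "\<epsilon> n = k (n - 1)" for n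
  have "x = (\<Sum>n. real (\<epsilon> (Suc n)) / real (2 * m + 2) ^ Suc n)"
    unfolding e(2) expansion_def b_def \<epsilon>_def k(2) by simp
  moreover have "\<forall>n\<ge>1. \<epsilon> n \<in> digits m" using k(1) by (simp add: \<epsilon>_def)
  ultimately show "x \<in> X m" unfolding X_def by blast
qed

sublocale D: digit_system b "real ` digits m" "b + 1"
  using b_ge_4 by unfold_locales (auto simp: digits_def b_def)

sublocale C: digit_system b "{0, 1, 2}" 2
  using b_ge_4 by (intro digit_system_012) simp

lemma X_bounds:
  assumes "x \<in> X m"
  shows "0 \<le> x" "x < 1 + 3 / b" "x < 2"
proof -
  have "x \<le> (b + 1) / (b - 1)" "0 \<le> x"
    using D.in_expansions_bounds assms by (auto simp: X_eq_expansions)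
  moreover have "(b + 1) / (b - 1) < 1 + 3 / b" "(b + 1) / (b - 1) < 2"
    using b_ge_4 by (simp_all add: field_simps)
  ultimately show "0 \<le> x" "x < 1 + 3 / b" "x < 2" by auto
qed

lemma X_step:
  assumes "x \<in> X m"
  obtains d y where "d \<in> digits m" "y \<in> X m" "x = (real d + y) / b"
proof -
  obtain e y where "e \<in> real ` digits m" "y \<in> expansions b (real ` digits m)" "x = (e + y) / b"
    using assms unfolding X_eq_expansions by (rule D.expansions_step)
  then show ?thesis using that unfolding X_eq_expansions by blast
qed

lemma in_X_Cons: "d \<in> digits m \<Longrightarrow> y \<in> X m \<Longrightarrow> (real d + y) / b \<in> X m"
  unfolding X_eq_expansions by (rule D.in_expansions_Cons) auto

lemma zero_in_X: "0 \<in> X m"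
proof -
  have "{0} \<subseteq> expansions b (real ` digits m)"
    by (rule D.subset_expansionsI) (auto simp: digits_def)
  then show ?thesis by (simp add: X_eq_expansions)
qed

lemma compact_X: "compact (X m)"
  unfolding X_eq_expansions by (rule D.compact_expansions)

text \<open>
  The neighbour graph of the tile. A point of \<open>X m\<close> whose translate by \<open>k\<close> is also in \<open>X m\<close>
  passes this property on to its tail, with a shift \<open>k'\<close> that is determined by the first digits.
  The shift \<open>0\<close> cannot occur, because no two digits differ by the base.
\<close>
lemma neighbour_step:
  assumes k: "k \<in> {-1, 1 :: int}" and d: "d \<in> digits m" "d' \<in> digits m"
    and y: "y \<in> X m" "y' \<in> X m"
    and eq: "(real d + y) / b + of_int k = (real d' + y') / b"
  obtains k' where "k' \<in> {-1, 1 :: int}" "y' = y + of_int k'"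
    "int d' - int d = int (2 * m + 2) * k - k'"
proof -
  define k' where "k' = int (2 * m + 2) * k + int d - int d'"
  have "real d + y + b * of_int k = real d' + y'"
    using eq b_ge_4 by (simp add: field_simps)
  then have y': "y' = y + of_int k'" by (simp add: k'_def b_def)
  then have "of_int k' < (2::real)" "of_int k' > (-2::real)"
    using X_bounds[OF y(1)] X_bounds[OF y(2)] by linarith+
  then have "k' < 2" "k' > -2" by linarith+
  moreover have "k' \<noteq> 0"
    using k d by (auto simp: digits_def k'_def)
  ultimately have "k' \<in> {-1, 1}" by auto
  then show ?thesis using that y' by (simp add: k'_def)
qed

lemma X_inter_translate_subset: "{x \<in> X m. x + 1 \<in> X m} \<subseteq> C" (is "?B \<subseteq> C")
proof (rule C.subset_expansionsI)
  show "bounded ?B"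
    using compact_imp_bounded[OF compact_X] by (rule bounded_subset) auto
  fix x assume "x \<in> ?B"
  then have x: "x \<in> X m" "x + 1 \<in> X m" by auto
  obtain d y where dy: "d \<in> digits m" "y \<in> X m" "x = (real d + y) / b"
    using x(1) by (rule X_step)
  obtain d' y' where dy': "d' \<in> digits m" "y' \<in> X m" "x + 1 = (real d' + y') / b"
    using x(2) by (rule X_step)
  obtain k where k: "k \<in> {-1, 1}" "y' = y + of_int k" "int d' - int d = int (2 * m + 2) * 1 - k"
    using neighbour_step[of 1 d d' y y'] dy dy' by auto
  show "\<exists>e\<in>{0, 1, 2}. \<exists>z\<in>?B. x = (e + z) / b"
  proof (cases "k = 1")
    case True
    then have "d = 0 \<or> d = 2" using k dy(1) dy'(1) by (auto simp: digits_def)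
    then have "real d \<in> {0, 1, 2}" by auto
    moreover have "y \<in> ?B" using dy dy' k True by auto
    ultimately show ?thesis using dy(3) by blast
  next
    case False
    then have k1: "k = -1" using k by simp
    then have "d = 0" using k dy(1) dy'(1) by (auto simp: digits_def)
    then have "x = (1 + y') / b" using dy(3) k k1 by simp
    moreover have "y' \<in> ?B" using dy dy' k k1 by auto
    ultimately show ?thesis by blast
  qed
qed

text \<open>
  If \<open>c \<in> C\<close> has first digit \<open>e\<close> and tail \<open>z\<close>, then \<open>c = (e + z) / b\<close> and
  \<open>1 + c = (b + e + z) / b\<close>. The numbers \<open>e\<close> and \<open>b + e\<close> are digits of \<open>X m\<close> except for \<open>1\<close>, \<open>b\<close>
  and \<open>b + 2\<close>. In these cases the digit is lowered by \<open>1\<close> and the tail \<open>z\<close> is raised to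
  \<open>1 + z\<close>.
\<close>
lemma C_and_translate_subset_X: "C \<union> (+) 1 ` C \<subseteq> X m" (is "?K \<subseteq> _")
  unfolding X_eq_expansions
proof (rule D.subset_expansionsI)
  show "bounded ?K" using C.bounded_expansions by (simp add: bounded_translation)
  have dig: "0 \<in> real ` digits m" "2 \<in> real ` digits m" "b - 1 \<in> real ` digits m"
    "b + 1 \<in> real ` digits m"
    using m_ge_1 unfolding b_def digits_def
    by (force intro: image_eqI[of _ _ 0] image_eqI[of _ _ 2] image_eqI[of _ _ "2 * m + 1"]
        image_eqI[of _ _ "2 * m + 3"])+
  fix x assume "x \<in> ?K"
  then obtain c where c: "c \<in> C" "x = c \<or> x = 1 + c" by auto
  obtain e z where ez: "e \<in> {0, 1, 2}" "z \<in> C" "c = (e + z) / b"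
    using c(1) by (rule C.expansions_step)
  have b0: "b \<noteq> 0" using b_ge_4 by simp
  have z: "z \<in> ?K" "1 + z \<in> ?K" using ez by auto
  have step: "\<exists>d\<in>real ` digits m. \<exists>y\<in>?K. x = (d + y) / b"
    if "d \<in> real ` digits m" "y \<in> ?K" "x = (d + y) / b" for d y using that by blast
  have x1: "x = (b + e + z) / b" if "x = 1 + c"
    using that ez b0 by (simp add: add_divide_distrib)
  consider "e = 0" | "e = 1" | "e = 2" using ez by auto
  then show "\<exists>d\<in>real ` digits m. \<exists>y\<in>?K. x = (d + y) / b"
  proof cases
    case 1
    show ?thesis using c(2)
    proof
      assume "x = c"
      then show ?thesis using step[OF dig(1) z(1)] 1 ez by simp
    next
      assume "x = 1 + c"
      then show ?thesis using step[OF dig(3) z(2)] 1 x1 by simp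
    qed
  next
    case 2
    show ?thesis using c(2)
    proof
      assume "x = c"
      then show ?thesis using step[OF dig(1) z(2)] 2 ez by simp
    next
      assume "x = 1 + c"
      then show ?thesis using step[OF dig(4) z(1)] 2 x1 by simp
    qed
  next
    case 3
    show ?thesis using c(2)
    proof
      assume "x = c"
      then show ?thesis using step[OF dig(2) z(1)] 3 ez by simp
    next
      assume "x = 1 + c"
      then show ?thesis using step[OF dig(4) z(2)] 3 x1 by (simp add: add_ac)
    qed
  qed
qed

lemma digit_residue:
  fixes k :: int
  obtains d q where "d \<in> digits m" "k = int d + int (2 * m + 2) * q"
proof -
  define r where "r = nat (k mod int (2 * m + 2))"
  have r: "int r = k mod int (2 * m + 2)" "r < 2 * m + 2"
    by (auto simp: r_def nat_less_iff)
  then have k: "k = int r + int (2 * m + 2) * (k div int (2 * m + 2))" by simp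
  show ?thesis
  proof (cases "r = 1")
    case True
    \<comment> \<open>The residue \<open>1\<close> is represented by the digit \<open>2 * m + 3\<close>.\<close>
    then have "k = int (2 * m + 3) + int (2 * m + 2) * (k div int (2 * m + 2) - 1)"
      using k by (simp add: algebra_simps)
    then show ?thesis by (intro that[of "2 * m + 3"]) (auto simp: digits_def)
  next
    case False
    then have "r \<in> digits m" using r(2) by (auto simp: digits_def)
    then show ?thesis using k by (rule that)
  qed
qed

text \<open>
  The translates cover the line because the digits represent all residues: their union is closed
  and contains all fractions with a power of \<open>b\<close> as denominator.
\<close>
lemma X_translates_cover: "(\<Union>x\<in>X m. \<Union>k\<in>\<int>. {x + k}) = UNIV" (is "?S = _")
proof -
  have closed: "closed ?S" by (intro compact_closed_sums compact_X closed_Ints)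
  have fractions: "of_int n / b ^ N \<in> ?S" for n N
  proof (induction N arbitrary: n)
    case 0
    have "of_int n / b ^ 0 = 0 + (of_int n :: real)" by simp
    then show ?case using zero_in_X Ints_of_int by blast
  next
    case (Suc N)
    then obtain x k where xk: "x \<in> X m" "k \<in> \<int>" "of_int n / b ^ N = x + k" by blast
    then obtain j where j: "k = of_int j" by (auto elim: Ints_cases)
    obtain d q where dq: "d \<in> digits m" "j = int d + int (2 * m + 2) * q"
      by (rule digit_residue)
    have "of_int n / b ^ Suc N = (x + k) / b" using xk(3) by (simp add: divide_simps)
    also have "\<dots> = (real d + x) / b + of_int q"
      using b_ge_4 unfolding j dq(2) by (simp add: b_def field_simps)
    finally show ?case using in_X_Cons[OF dq(1) xk(1)] Ints_of_int[of q] by blast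
  qed
  have "t \<in> closure ?S" for t :: real
    unfolding closure_approachable
  proof (intro allI impI)
    fix \<epsilon> :: real assume "\<epsilon> > 0"
    then obtain N where N: "(1 / b) ^ N < \<epsilon>"
      using real_arch_pow_inv[of \<epsilon> "1 / b"] b_ge_4 by auto
    have pos: "b ^ N > 0" using b_ge_4 by simp
    have "\<bar>of_int \<lfloor>t * b ^ N\<rfloor> - t * b ^ N\<bar> \<le> 1" by linarith
    then have "\<bar>of_int \<lfloor>t * b ^ N\<rfloor> - t * b ^ N\<bar> / b ^ N \<le> 1 / b ^ N"
      using pos by (intro divide_right_mono) auto
    also have "\<bar>of_int \<lfloor>t * b ^ N\<rfloor> - t * b ^ N\<bar> / b ^ N
        = \<bar>(of_int \<lfloor>t * b ^ N\<rfloor> - t * b ^ N) / b ^ N\<bar>"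
      using pos by simp
    also have "(of_int \<lfloor>t * b ^ N\<rfloor> - t * b ^ N) / b ^ N = of_int \<lfloor>t * b ^ N\<rfloor> / b ^ N - t"
      using b_ge_4 by (simp add: diff_divide_distrib)
    finally have "dist (of_int \<lfloor>t * b ^ N\<rfloor> / b ^ N) t < \<epsilon>"
      using N by (simp add: dist_real_def power_one_over)
    then show "\<exists>y\<in>?S. dist y t < \<epsilon>" using fractions by blast
  qed
  then show ?thesis using closed by (auto simp: closure_closed)
qed

lemma frontier_X_subset: "frontier (X m) \<subseteq> C \<union> (+) 1 ` C"
proof
  fix x assume x: "x \<in> frontier (X m)"
  define T where "T = (\<Union>x\<in>X m. \<Union>k\<in>\<int> - {0}. {x + k :: real})"
  have "closed T"
    unfolding T_def by (intro compact_closed_sums compact_X closed_subset_Ints) auto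
  have xX: "x \<in> X m"
    using x frontier_subset_closed[OF compact_imp_closed[OF compact_X]] by blast
  have "- T \<subseteq> X m"
  proof
    fix t assume t: "t \<in> - T"
    obtain y k where yk: "y \<in> X m" "k \<in> \<int>" "t = y + k" using X_translates_cover by blast
    with t have "k = 0" unfolding T_def by blast
    then show "t \<in> X m" using yk by simp
  qed
  then have "- T \<subseteq> interior (X m)" using \<open>closed T\<close> by (intro interior_maximal) auto
  then have "x \<in> T" using x by (auto simp: frontier_def)
  then obtain y j where y: "y \<in> X m" and j: "j \<in> \<int>" "j \<noteq> 0" and xy: "x = y + j"
    unfolding T_def by blast
  obtain k where k: "j = of_int k" using j by (auto elim: Ints_cases)
  have "of_int k < (2::real)" "of_int k > (-2::real)"
    using X_bounds[OF y] X_bounds[OF xX] xy k by linarith+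
  then have "k = 1 \<or> k = -1" using j k by (cases "k = 0") auto
  then show "x \<in> C \<union> (+) 1 ` C"
  proof
    assume "k = 1"
    then have "y \<in> C" using X_inter_translate_subset y xX xy k by auto
    then show ?thesis using xy k \<open>k = 1\<close> by auto
  next
    assume "k = -1"
    then have "x \<in> C" using X_inter_translate_subset y xX xy k by auto
    then show ?thesis by auto
  qed
qed

text \<open>
  The point \<open>3 / b\<close> lies in no other translate of the tile, because \<open>1 + 3 / b\<close> is above and
  \<open>3 / b - 1\<close> is below all points of \<open>X m\<close>. By the neighbour graph this is also
  true of its images under the maps that generate the tile, and these are dense in it.
\<close>
lemma points_without_neighbours_dense:
  "x \<in> X m \<Longrightarrow> \<exists>y\<in>X m. y + 1 \<notin> X m \<and> y - 1 \<notin> X m \<and> \<bar>y - x\<bar> \<le> 2 / b ^ N"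
proof (induction N arbitrary: x)
  case 0
  have "3 \<in> digits m" using m_ge_1 by (auto simp: digits_def)
  then have "3 / b \<in> X m" using in_X_Cons[OF _ zero_in_X, of 3] by simp
  moreover have "3 / b + 1 \<notin> X m" using X_bounds(2)[of "3 / b + 1"] by auto
  moreover have "3 / b - 1 < 0" using b_ge_4 by (simp add: field_simps)
  then have "3 / b - 1 \<notin> X m" using X_bounds(1)[of "3 / b - 1"] by auto
  moreover have "\<bar>3 / b - x\<bar> \<le> 2"
    using X_bounds[OF 0] X_bounds[OF \<open>3 / b \<in> X m\<close>] by linarith
  ultimately show ?case by (intro bexI[of _ "3 / b"]) auto
next
  case (Suc N)
  obtain d x' where x': "d \<in> digits m" "x' \<in> X m" "x = (real d + x') / b"
    using Suc.prems by (rule X_step)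
  obtain y where y: "y \<in> X m" "y + 1 \<notin> X m" "y - 1 \<notin> X m" "\<bar>y - x'\<bar> \<le> 2 / b ^ N"
    using Suc.IH[OF x'(2)] by blast
  define z where "z = (real d + y) / b"
  have no_neighbour: "z + of_int k \<notin> X m" if k: "k \<in> {-1, 1}" for k
  proof
    assume "z + of_int k \<in> X m"
    then obtain d' y' where y': "d' \<in> digits m" "y' \<in> X m" "z + of_int k = (real d' + y') / b"
      by (rule X_step)
    obtain k' where "k' \<in> {-1, 1}" "y' = y + of_int k'"
      using neighbour_step[OF k x'(1) y'(1) y(1) y'(2) y'(3)[unfolded z_def]] by blast
    then show False using y y' by auto
  qed
  have "\<bar>z - x\<bar> = \<bar>y - x'\<bar> / b"
    using b_ge_4 by (simp add: z_def x'(3) flip: diff_divide_distrib)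
  also have "\<dots> \<le> 2 / b ^ N / b" using y(4) b_ge_4 by (intro divide_right_mono) auto
  finally have "\<bar>z - x\<bar> \<le> 2 / b ^ Suc N" by (simp add: mult.commute)
  moreover have "z \<in> X m" unfolding z_def by (rule in_X_Cons[OF x'(1) y(1)])
  ultimately show ?case using no_neighbour[of 1] no_neighbour[of "-1"] by auto
qed

lemma translate_C_subset_frontier_X: "(+) 1 ` C \<subseteq> frontier (X m)"
proof clarify
  fix c assume "c \<in> C"
  then have c: "c \<in> X m" "1 + c \<in> X m" using C_and_translate_subset_X by auto
  show "1 + c \<in> frontier (X m)"
    unfolding frontier_straddle
  proof (intro allI impI conjI)
    fix \<epsilon> :: real assume "\<epsilon> > 0"
    then show "\<exists>x\<in>X m. dist (1 + c) x < \<epsilon>" using c by (intro bexI[of _ "1 + c"]) auto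
    obtain N where "(1 / b) ^ N < \<epsilon> / 2"
      using real_arch_pow_inv[of "\<epsilon> / 2" "1 / b"] b_ge_4 \<open>\<epsilon> > 0\<close> by auto
    then have N: "2 / b ^ N < \<epsilon>" by (simp add: power_one_over)
    obtain y where "y + 1 \<notin> X m" "\<bar>y - c\<bar> \<le> 2 / b ^ N"
      using points_without_neighbours_dense[OF c(1)] by blast
    then show "\<exists>x. x \<notin> X m \<and> dist (1 + c) x < \<epsilon>"
      using N by (intro exI[of _ "y + 1"]) (auto simp: dist_real_def)
  qed
qed

lemma hausdorff_measure_frontier_X:
  assumes s: "s > log b 3"
  shows "hausdorff_measure s (frontier (X m)) = 0"
proof -
  have s0: "s > 0" using s b_ge_4 zero_less_log_cancel_iff[of b 3] by linarith
  define q where "q = 3 / b powr s"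
  have "b powr log b 3 < b powr s" using s b_ge_4 by (intro powr_less_mono) auto
  then have "3 < b powr s" using b_ge_4 by simp
  moreover have "b powr s > 0" using b_ge_4 by simp
  ultimately have q: "0 \<le> q" "q < 1" by (simp_all add: q_def)
  have card3: "card {0, 1, 2 :: real} = 3" by (simp add: eval_nat_numeral)
  have "hausdorff_premeasure s \<delta> (frontier (X m)) \<le> 0" if \<delta>: "\<delta> > 0" for \<delta>
  proof (rule LIMSEQ_le_const)
    have "(\<lambda>N. 2 * q ^ N) \<longlonglongrightarrow> 0"
      using q by (intro tendsto_mult_right_zero LIMSEQ_power_zero) auto
    then show "(\<lambda>N. ennreal (2 * q ^ N)) \<longlonglongrightarrow> 0"
      using tendsto_ennrealI by fastforce
    obtain N0 where N0: "(1 / b) ^ N0 < \<delta>"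
      using real_arch_pow_inv[of \<delta> "1 / b"] b_ge_4 \<delta> by auto
    have "hausdorff_premeasure s \<delta> (frontier (X m)) \<le> ennreal (2 * q ^ N)" if "N \<ge> N0" for N
    proof -
      define r where "r = (1 / b) ^ N"
      have "r \<le> (1 / b) ^ N0"
        unfolding r_def using that b_ge_4 by (intro power_decreasing) auto
      then have "r \<le> \<delta>" using N0 by simp
      have "0 \<le> r" using b_ge_4 by (simp add: r_def)
      obtain F where F: "finite F" "card F \<le> 3 ^ N"
        and cov: "C \<subseteq> (\<Union>p\<in>F. {p..p + 2 / (b - 1) / b ^ N})"
        using C.expansions_cover[of N] unfolding card3 by blast
      have "2 / (b - 1) / b ^ N \<le> 1 / b ^ N"
        using b_ge_4 by (intro divide_right_mono) auto
      then have len: "2 / (b - 1) / b ^ N \<le> r" by (simp add: r_def power_one_over)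
      define G where "G = F \<union> (+) 1 ` F"
      have "card G \<le> card F + card ((+) 1 ` F)" unfolding G_def by (rule card_Un_le)
      then have "card G \<le> 2 * 3 ^ N" using F card_image_le[OF F(1), of "(+) 1"] by linarith
      moreover have "finite G" using F by (simp add: G_def)
      moreover have "frontier (X m) \<subseteq> (\<Union>p\<in>G. {p..p + r})"
      proof
        fix x assume "x \<in> frontier (X m)"
        then obtain c where c: "c \<in> C" "x = c \<or> x = 1 + c" using frontier_X_subset by blast
        then obtain p where p: "p \<in> F" "p \<le> c" "c \<le> p + r" using cov len by fastforce
        show "x \<in> (\<Union>p\<in>G. {p..p + r})" using c(2)
        proof
          assume "x = c"
          then show ?thesis using p by (auto simp: G_def)
        next
          assume "x = 1 + c"
          then have "x \<in> {1 + p..1 + p + r}" using p by simp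
          moreover have "1 + p \<in> G" using p by (simp add: G_def)
          ultimately show ?thesis by blast
        qed
      qed
      ultimately have "hausdorff_premeasure s \<delta> (frontier (X m))
          \<le> ennreal (real (2 * 3 ^ N) * r powr s)"
        by (intro hausdorff_premeasure_le_intervals s0 \<open>0 \<le> r\<close> \<open>r \<le> \<delta>\<close>)
      moreover have "r powr s = 1 / (b powr s) ^ N"
      proof -
        have "r = b powr - real N"
          using b_ge_4 by (simp add: r_def power_one_over powr_minus powr_realpow inverse_eq_divide)
        then have "r powr s = (b powr s) powr - real N" by (simp only: powr_powr mult.commute)
        then show ?thesis using b_ge_4 by (simp add: powr_minus powr_realpow inverse_eq_divide)
      qed
      ultimately show ?thesis by (simp add: q_def power_divide)
    qed
    then show "\<exists>N. \<forall>n\<ge>N. hausdorff_premeasure s \<delta> (frontier (X m)) \<le> ennreal (2 * q ^ n)"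
      by blast
  qed
  then have "hausdorff_measure s (frontier (X m)) \<le> 0"
    unfolding hausdorff_measure_def by (intro SUP_least) simp
  then show ?thesis by simp
qed

lemma log_le_hausdorff_dim_frontier_X: "ereal (log b 3) \<le> hausdorff_dim (frontier (X m))"
proof (rule hausdorff_dim_ge_if_hoelder)
  let ?I = "{e :: nat \<Rightarrow> real. \<forall>n. e n \<in> {0, 1, 2}}"
  show "log b 3 > 0" using b_ge_4 by (subst zero_less_log_cancel_iff) auto
  show "(9::real) > 0" by simp
  show "1 + expansion b e \<in> frontier (X m)" if "e \<in> ?I" for e
    using that translate_C_subset_frontier_X unfolding expansions_def by blast
  show "{0..1} \<subseteq> expansion 3 ` ?I"
    using unit_interval_subset_ternary unfolding expansions_def by blast
  show "\<bar>expansion 3 e - expansion 3 f\<bar>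
      \<le> 9 * dist (1 + expansion b e) (1 + expansion b f) powr log b 3"
    if "e \<in> ?I" "f \<in> ?I" for e f
    using expansion_012_hoelder[OF b_ge_4, of e f] that by (simp add: dist_real_def)
qed

end

theorem theorem6:
  fixes m :: nat
  assumes "m \<ge> 1"
  shows "hausdorff_dim (X_C m) = ereal (log (real (2 * m + 2)) 3)"
proof -
  interpret tile m using assms by unfold_locales
  have "0 \<le> log b 3" using b_ge_4 by (simp add: zero_le_log_cancel_iff)
  then have "hausdorff_dim (frontier (X m)) = ereal (log b 3)"
    by (intro antisym hausdorff_dim_le hausdorff_measure_frontier_X
        log_le_hausdorff_dim_frontier_X)
  then show ?thesis by (simp only: X_C_def b_def)
qed

end
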